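(* Let $T$ be a locally finite rooted tree. (1) If a pronilpotent group $G$ has a faithful representation in $Iso(T)$ with a small number of isometry types, then the number of primes dividing $|G|$ is finite. (2) If a nilpotent profinite group $G$ has a faithful representation in $Iso(T)$ with a small number of isometry types, then the periodic part of $G$ is of finite exponent.
   Context: $T$ is an infinite locally finite tree with root $\emptyset$, of the form $T_{\bar m}$ for a sequence $\bar m=m_1,m_2,\dots$ of positive natural numbers, meaning that every vertex at distance $n$ from the root has exactly $m_{n+1}$ neighbours at distance $n+1$ from the root. $Iso(T)$ is the profinite group of all isometries of $T$ fixing the root. A faithful representation of a profinite group $G$ in $Iso(T)$ is a continuous injective homomorphism $G\to Iso(T)$, so $G$ is realized as a closed subgroup of $Iso(T)$. It has a small number of isometry types if the image of $G$ meets fewer than $2^{\aleph_0}$ conjugacy classes of $Iso(T)$. $|G|$ is the order of the profinite group $G$ as a supernatural number; a prime divides $|G|$ if it divides the order of some finite continuous quotient of $G$. The periodic part of $G$ is the set of its elements of finite order. *)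

theory Defs
  imports
    "HOL-Analysis.Analysis"
    "HOL-Algebra.Bij"
    "HOL-Algebra.Generated_Groups"
    "HOL-Library.Equipollence"
begin

section \<open>Rooted trees and their isometry groups\<close>

definition simple_path :: "'v set \<Rightarrow> ('v \<times> 'v) set \<Rightarrow> 'v \<Rightarrow> 'v \<Rightarrow> 'v list \<Rightarrow> bool" where
  "simple_path V E u v p \<longleftrightarrow>
     p \<noteq> [] \<and> set p \<subseteq> V \<and> distinct p \<and> hd p = u \<and> last p = v \<and>
     successively (\<lambda>x y. (x, y) \<in> E) p"

text \<open>An undirected edge is represented by both of its orientations.\<close>

locale rooted_tree =
  fixes V :: "'v set" and E :: "('v \<times> 'v) set" and r :: 'v
  assumes edges: "E \<subseteq> V \<times> V" "sym E" "irrefl E"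
    and root_in: "r \<in> V"
    and unique_path: "\<And>u v. u \<in> V \<Longrightarrow> v \<in> V \<Longrightarrow> \<exists>!p. simple_path V E u v p"

text \<open>The path metric; the value is junk for vertices in different components.\<close>

definition graph_dist :: "('v \<times> 'v) set \<Rightarrow> 'v \<Rightarrow> 'v \<Rightarrow> nat" where
  "graph_dist E u v = (LEAST n. (u, v) \<in> E ^^ n)"

text \<open>The tree determined up to isomorphism by the sequence \<open>m 1, m 2, \<dots>\<close>; the value \<open>m 0\<close> is
  not used. Since \<open>card\<close> of an infinite set is \<open>0\<close>, positivity of \<open>m\<close> makes the tree locally
  finite (and infinite).\<close>

locale homogeneous_tree = rooted_tree V E r
  for V :: "'v set" and E r +
  fixes m :: "nat \<Rightarrow> nat"
  assumes m_pos: "\<And>n. 0 < m (Suc n)"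
    and branching: "\<And>v. v \<in> V \<Longrightarrow>
      card {w. (v, w) \<in> E \<and> graph_dist E r w = Suc (graph_dist E r v)}
        = m (Suc (graph_dist E r v))"

definition isometries :: "'v set \<Rightarrow> ('v \<times> 'v) set \<Rightarrow> 'v \<Rightarrow> ('v \<Rightarrow> 'v) set" where
  "isometries V E r = {f \<in> Bij V. f r = r \<and>
     (\<forall>x\<in>V. \<forall>y\<in>V. graph_dist E (f x) (f y) = graph_dist E x y)}"

definition Iso :: "'v set \<Rightarrow> ('v \<times> 'v) set \<Rightarrow> 'v \<Rightarrow> ('v \<Rightarrow> 'v) monoid" where
  "Iso V E r = (BijGroup V)\<lparr>carrier := isometries V E r\<rparr>"

text \<open>The topology of pointwise convergence on the discrete set of vertices. As the balls about
  the root are finite, this is the profinite topology, in which the pointwise stabilisers of the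
  balls form a base of neighbourhoods of the identity.\<close>

definition Iso_topology :: "'v set \<Rightarrow> ('v \<times> 'v) set \<Rightarrow> 'v \<Rightarrow> ('v \<Rightarrow> 'v) topology" where
  "Iso_topology V E r =
     subtopology (product_topology (\<lambda>_. discrete_topology V) V) (isometries V E r)"

lemma group_Iso:
  assumes "r \<in> V"
  shows "group (Iso V E r)"
proof -
  interpret B: group "BijGroup V" by (rule group_BijGroup)
  have inv: "inv\<^bsub>BijGroup V\<^esub> f = restrict (inv_into V f) V" if "f \<in> Bij V" for f
    using that by (rule inv_BijGroup)
  have "subgroup (isometries V E r) (BijGroup V)"
  proof (rule B.subgroupI)
    show "isometries V E r \<subseteq> carrier (BijGroup V)"
      by (auto simp: isometries_def BijGroup_def)
    have "(\<lambda>x\<in>V. x) \<in> isometries V E r"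
      using assms by (auto simp: isometries_def id_Bij)
    then show "isometries V E r \<noteq> {}" by blast
  next
    fix f assume f: "f \<in> isometries V E r"
    then have B: "f \<in> Bij V" and b: "bij_betw f V V"
      by (auto simp: isometries_def Bij_def)
    have "inv_into V f r = r"
      using f assms b by (metis (mono_tags, lifting) bij_betw_inv_into_left isometries_def mem_Collect_eq)
    moreover have "graph_dist E (inv_into V f x) (inv_into V f y) = graph_dist E x y"
      if "x \<in> V" "y \<in> V" for x y
    proof -
      have "inv_into V f x \<in> V" "inv_into V f y \<in> V" using that B by (auto intro: Bij_inv_into_mem)
      then have "graph_dist E (f (inv_into V f x)) (f (inv_into V f y))
          = graph_dist E (inv_into V f x) (inv_into V f y)"
        using f by (auto simp: isometries_def)
      then show ?thesis using b that by (simp add: bij_betw_inv_into_right)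
    qed
    ultimately show "inv\<^bsub>BijGroup V\<^esub> f \<in> isometries V E r"
      using B assms by (auto simp: inv isometries_def restrict_inv_into_Bij)
  next
    fix f g assume f: "f \<in> isometries V E r" and g: "g \<in> isometries V E r"
    then have "f \<in> Bij V" "g \<in> Bij V" by (auto simp: isometries_def)
    moreover have "g x \<in> V" if "x \<in> V" for x
      using \<open>g \<in> Bij V\<close> that Bij_imp_funcset by blast
    ultimately show "f \<otimes>\<^bsub>BijGroup V\<^esub> g \<in> isometries V E r"
      using f g assms by (auto simp: BijGroup_def isometries_def compose_Bij compose_eq)
  qed
  then show ?thesis
    unfolding Iso_def by (rule subgroup.subgroup_is_group) (rule group_BijGroup)
qed

section \<open>Profinite groups\<close>

locale topological_group = group G
  for G :: "('g, 'b) monoid_scheme" (structure) +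
  fixes \<tau> :: "'g topology"
  assumes topspace: "topspace \<tau> = carrier G"
    and continuous_mult: "continuous_map (prod_topology \<tau> \<tau>) \<tau> (\<lambda>(x, y). x \<otimes> y)"
    and continuous_inv: "continuous_map \<tau> \<tau> (\<lambda>x. inv x)"

definition totally_disconnected_space :: "'a topology \<Rightarrow> bool" where
  "totally_disconnected_space \<tau> \<longleftrightarrow> (\<forall>S. connectedin \<tau> S \<longrightarrow> (\<exists>a. S \<subseteq> {a}))"

locale profinite_group = topological_group G \<tau>
  for G :: "('g, 'b) monoid_scheme" (structure) and \<tau> :: "'g topology" +
  assumes compact: "compact_space \<tau>"
    and Hausdorff: "Hausdorff_space \<tau>"
    and totally_disconnected: "totally_disconnected_space \<tau>"

text \<open>The kernels of the continuous homomorphisms onto finite (discrete) groups are exactly the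
  open normal subgroups of finite index.\<close>

definition finite_quotient_kernels ::
  "('g, 'b) monoid_scheme \<Rightarrow> 'g topology \<Rightarrow> 'g set set" where
  "finite_quotient_kernels G \<tau> = {N. N \<lhd> G \<and> openin \<tau> N \<and> finite (carrier (G Mod N))}"

text \<open>The primes dividing the supernatural number \<open>|G|\<close>.\<close>

definition order_primes :: "('g, 'b) monoid_scheme \<Rightarrow> 'g topology \<Rightarrow> nat set" where
  "order_primes G \<tau> =
     {p. prime p \<and> (\<exists>N\<in>finite_quotient_kernels G \<tau>. p dvd order (G Mod N))}"

primrec lower_central :: "('g, 'b) monoid_scheme \<Rightarrow> nat \<Rightarrow> 'g set" where
  "lower_central G 0 = carrier G"
| "lower_central G (Suc n) = generate G
     {a \<otimes>\<^bsub>G\<^esub> b \<otimes>\<^bsub>G\<^esub> inv\<^bsub>G\<^esub> a \<otimes>\<^bsub>G\<^esub> inv\<^bsub>G\<^esub> b | a b. a \<in> lower_central G n \<and> b \<in> carrier G}"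

definition nilpotent_group :: "('g, 'b) monoid_scheme \<Rightarrow> bool" where
  "nilpotent_group G \<longleftrightarrow> group G \<and> (\<exists>n. lower_central G n = {\<one>\<^bsub>G\<^esub>})"

definition pronilpotent_group :: "('g, 'b) monoid_scheme \<Rightarrow> 'g topology \<Rightarrow> bool" where
  "pronilpotent_group G \<tau> \<longleftrightarrow> profinite_group G \<tau> \<and>
     (\<forall>N\<in>finite_quotient_kernels G \<tau>. nilpotent_group (G Mod N))"

definition periodic_part :: "('g, 'b) monoid_scheme \<Rightarrow> 'g set" where
  "periodic_part G = {g \<in> carrier G. \<exists>n::nat. 0 < n \<and> g [^]\<^bsub>G\<^esub> n = \<one>\<^bsub>G\<^esub>}"

definition finite_exponent :: "('g, 'b) monoid_scheme \<Rightarrow> 'g set \<Rightarrow> bool" where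
  "finite_exponent G A \<longleftrightarrow> (\<exists>n::nat. 0 < n \<and> (\<forall>g\<in>A. g [^]\<^bsub>G\<^esub> n = \<one>\<^bsub>G\<^esub>))"

section \<open>Representations and isometry types\<close>

definition conjugacy_class :: "('g, 'b) monoid_scheme \<Rightarrow> 'g \<Rightarrow> 'g set" where
  "conjugacy_class G x = {g \<otimes>\<^bsub>G\<^esub> x \<otimes>\<^bsub>G\<^esub> inv\<^bsub>G\<^esub> g | g. g \<in> carrier G}"

definition conjugacy_classes :: "('g, 'b) monoid_scheme \<Rightarrow> 'g set set" where
  "conjugacy_classes G = conjugacy_class G ` carrier G"

definition faithful_representation ::
  "('g, 'b) monoid_scheme \<Rightarrow> 'g topology \<Rightarrow> 'v set \<Rightarrow> ('v \<times> 'v) set \<Rightarrow> 'v \<Rightarrow>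
     ('g \<Rightarrow> 'v \<Rightarrow> 'v) \<Rightarrow> bool" where
  "faithful_representation G \<tau> V E r \<rho> \<longleftrightarrow>
     \<rho> \<in> hom G (Iso V E r) \<and> inj_on \<rho> (carrier G) \<and>
     continuous_map \<tau> (Iso_topology V E r) \<rho>"

definition small_isometry_types ::
  "('g, 'b) monoid_scheme \<Rightarrow> 'v set \<Rightarrow> ('v \<times> 'v) set \<Rightarrow> 'v \<Rightarrow> ('g \<Rightarrow> 'v \<Rightarrow> 'v) \<Rightarrow> bool" where
  "small_isometry_types G V E r \<rho> \<longleftrightarrow>
     {C \<in> conjugacy_classes (Iso V E r). C \<inter> \<rho> ` carrier G \<noteq> {}} \<prec> (UNIV :: nat set set)"

end

theory Submission
  imports Defs "HOL-Algebra.Sylow" "HOL-Algebra.Multiplicative_Group"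
begin

text \<open>
  Let \<open>K l\<close> be the open normal subgroup of those elements of \<open>G\<close> that fix the ball of radius \<open>l\<close>
  pointwise. Whether \<open>g\<^sup>e \<in> K l\<close> depends only on the isometry type of \<open>g\<close>, so it suffices to find
  elements \<open>a A\<close> for \<open>A \<subseteq> \<nat>\<close> that are pairwise distinguished by such conditions. They are limits
  of a binary tree of elements of \<open>G\<close>: at every stage, each element of a finite set is changed
  modulo the current \<open>K l\<close> in two ways, one with \<open>g\<^sup>e \<in> K l'\<close> and one with \<open>g\<^sup>e \<notin> K l'\<close>.
  The two modifications differ by a central factor. In a nilpotent group, a bound on the torsion of
  the center bounds all torsion. So if the periodic part of a nilpotent \<open>G\<close> has infinite exponent,
  there are central torsion elements of unbounded order, and their powers lie arbitrarily deep.
  If infinitely many primes divide the order of a pronilpotent \<open>G\<close>, choose \<open>p\<close> not dividing the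
  index of \<open>K l\<close>; then some nilpotent \<open>G/K l'\<close> has a central element of \<open>p\<close>-power order, which is
  trivial modulo \<open>K l\<close>.
\<close>

section \<open>Torsion and the upper central series\<close>

lemma (in normal) rcos_eq_one_iff:
  assumes "x \<in> carrier G"
  shows "H #> x = H \<longleftrightarrow> x \<in> H"
  using assms coset_join1 coset_join2 is_subgroup subset by blast

lemma (in normal) rcos_eq_iff:
  assumes "x \<in> carrier G" "y \<in> carrier G"
  shows "H #> x = H #> y \<longleftrightarrow> x \<otimes> inv y \<in> H"
proof -
  have "H #> x = H #> y \<longleftrightarrow> x \<in> H #> y"
    using assms is_subgroup repr_independence rcos_self by blast
  also have "\<dots> \<longleftrightarrow> x \<otimes> inv y \<in> H"
    using assms rcos_module is_group by blast
  finally show ?thesis .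
qed

lemma (in normal) commutator_in_iff:
  assumes "x \<in> carrier G" "y \<in> carrier G"
  shows "x \<otimes> y \<otimes> inv x \<otimes> inv y \<in> H \<longleftrightarrow> (H #> x) <#> (H #> y) = (H #> y) <#> (H #> x)"
  using rcos_eq_iff[of "x \<otimes> y" "y \<otimes> x"] assms by (simp add: rcos_sum inv_mult_group m_assoc)

lemma (in normal) group_hom_Mod: "group_hom G (G Mod H) (\<lambda>x. H #> x)"
  by (simp add: group_hom_def group_hom_axioms_def is_group factorgroup_is_group r_coset_hom_Mod)

lemma (in normal) kernel_Mod: "kernel G (G Mod H) (\<lambda>x. H #> x) = H"
  using rcos_eq_one_iff subset by (auto simp: kernel_def)

lemma (in normal) pow_index_in:
  assumes "x \<in> carrier G"
  shows "x [^] order (G Mod H) \<in> H"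
proof -
  interpret Q: group "G Mod H" by (rule factorgroup_is_group)
  have "H #> x \<in> carrier (G Mod H)"
    using assms by (auto simp: carrier_FactGroup)
  from Q.pow_order_eq_1[OF this] show ?thesis
    using assms by (simp add: FactGroup_pow rcos_eq_one_iff)
qed

lemma (in subgroup) pow_dvd_closed:
  fixes m n :: nat
  assumes "group G" "x \<in> carrier G" "x [^] m \<in> H" "m dvd n"
  shows "x [^] n \<in> H"
proof -
  interpret group G by fact
  obtain k where "n = m * k" using assms by blast
  moreover have "(x [^] m) [^] k \<in> H"
    using assms subgroup_int_pow_closed[OF subgroup_axioms, of _ "int k"] by (simp add: int_pow_int)
  ultimately show ?thesis using assms by (simp add: nat_pow_pow)
qed

text \<open>By Bezout, \<open>x\<close> is a product of integer powers of \<open>x [^] m\<close> and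
  \<open>x [^] n\<close>. This separates behaviour at a prime \<open>p\<close> from behaviour prime
  to \<open>p\<close>.\<close>

lemma (in subgroup) pow_coprime_closed:
  fixes m n :: nat
  assumes "group G" "x \<in> carrier G" "x [^] m \<in> H" "x [^] n \<in> H" "coprime m n"
  shows "x \<in> H"
proof -
  interpret group G by fact
  obtain u v where "u * int m + v * int n = 1"
    using assms(5) by (metis bezout_int coprime_iff_gcd_eq_1 gcd_int_int_eq of_nat_1)
  then have "x = x [^] (int m * u + int n * v)"
    using assms(2) by (simp add: algebra_simps)
  also have "\<dots> = (x [^] m) [^] u \<otimes> (x [^] n) [^] v"
    using assms(2) by (simp add: int_pow_mult int_pow_pow flip: int_pow_int)
  also have "\<dots> \<in> H"
    using assms(3,4) subgroup_int_pow_closed[OF subgroup_axioms] by simp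
  finally show ?thesis .
qed

section \<open>The upper central series modulo a normal subgroup\<close>

text \<open>With \<open>N = {\<one>}\<close> this is the upper central series of \<open>G\<close>; in general it is the preimage of the
  upper central series of \<open>G Mod N\<close>.\<close>

primrec upper_central :: "('g, 'b) monoid_scheme \<Rightarrow> 'g set \<Rightarrow> nat \<Rightarrow> 'g set" where
  "upper_central G N 0 = N"
| "upper_central G N (Suc i) = {x \<in> carrier G. \<forall>y\<in>carrier G.
     x \<otimes>\<^bsub>G\<^esub> y \<otimes>\<^bsub>G\<^esub> inv\<^bsub>G\<^esub> x \<otimes>\<^bsub>G\<^esub> inv\<^bsub>G\<^esub> y \<in> upper_central G N i}"

lemma (in group) inv_commutes:
  assumes "x \<in> carrier G" "y \<in> carrier G" "x \<otimes> y = y \<otimes> x"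
  shows "inv x \<otimes> y = y \<otimes> inv x"
proof -
  have "inv x \<otimes> y = inv x \<otimes> (y \<otimes> x) \<otimes> inv x"
    using assms(1,2) by (simp add: m_assoc)
  also have "\<dots> = inv x \<otimes> (x \<otimes> y) \<otimes> inv x"
    using assms(3) by simp
  also have "\<dots> = y \<otimes> inv x"
    using assms(1,2) by (simp add: m_assoc flip: m_assoc[of "inv x" x])
  finally show ?thesis .
qed

lemma (in group) mult_commutes:
  assumes "x \<in> carrier G" "y \<in> carrier G" "z \<in> carrier G"
    and "x \<otimes> z = z \<otimes> x" "y \<otimes> z = z \<otimes> y"
  shows "x \<otimes> y \<otimes> z = z \<otimes> (x \<otimes> y)"
  using assms by (metis m_assoc)

text \<open>The set is the preimage of the center of \<open>G Mod H\<close>; all closure properties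
  are checked as commutation relations in that quotient.\<close>

lemma (in normal) normal_upper_central_step:
  "{x \<in> carrier G. \<forall>y\<in>carrier G. x \<otimes> y \<otimes> inv x \<otimes> inv y \<in> H} \<lhd> G" (is "?Z \<lhd> G")
proof -
  interpret Q: group "G Mod H" by (rule factorgroup_is_group)
  define f where "f x = H #> x" for x
  interpret f: group_hom G "G Mod H" f
    unfolding f_def by (rule group_hom_Mod)
  have Z: "?Z = {x \<in> carrier G. \<forall>y\<in>carrier G. f x \<otimes>\<^bsub>G Mod H\<^esub> f y = f y \<otimes>\<^bsub>G Mod H\<^esub> f x}"
    using commutator_in_iff by (auto simp: f_def)
  have com: "f x \<otimes>\<^bsub>G Mod H\<^esub> f y = f y \<otimes>\<^bsub>G Mod H\<^esub> f x" if "x \<in> ?Z" "y \<in> carrier G" for x y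
    using that unfolding Z by blast
  have "subgroup ?Z G"
  proof (rule subgroupI)
    show "?Z \<subseteq> carrier G" by blast
    have "\<one> \<in> ?Z" unfolding Z by (simp del: mult_FactGroup one_FactGroup)
    then show "?Z \<noteq> {}" by blast
  next
    fix a assume "a \<in> ?Z"
    then show "inv a \<in> ?Z" unfolding Z
      by (simp add: Q.inv_commutes del: mult_FactGroup)
  next
    fix a b assume ab: "a \<in> ?Z" "b \<in> ?Z"
    then have car: "a \<in> carrier G" "b \<in> carrier G" by auto
    have "f (a \<otimes> b) \<otimes>\<^bsub>G Mod H\<^esub> f y = f y \<otimes>\<^bsub>G Mod H\<^esub> f (a \<otimes> b)" if "y \<in> carrier G" for y
      unfolding f.hom_mult[OF car]
      by (intro Q.mult_commutes com ab f.hom_closed car that)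
    with car show "a \<otimes> b \<in> ?Z" unfolding Z by blast
  qed
  moreover have "g \<otimes> x \<otimes> inv g \<in> ?Z" if "g \<in> carrier G" "x \<in> ?Z" for g x
  proof -
    have x: "x \<in> carrier G" using that by simp
    have "f (g \<otimes> x \<otimes> inv g) = f g \<otimes>\<^bsub>G Mod H\<^esub> f x \<otimes>\<^bsub>G Mod H\<^esub> inv\<^bsub>G Mod H\<^esub> f g"
      using that(1) x by (simp del: mult_FactGroup)
    also have "\<dots> = f x"
      unfolding com[OF that(2,1), symmetric]
      using that(1) x by (simp add: Q.m_assoc del: mult_FactGroup one_FactGroup)
    finally show ?thesis
      using com[OF that(2)] that(1) x unfolding Z by simp
  qed
  ultimately show ?thesis
    by (simp add: normal_inv_iff)
qed

lemma (in group) normal_upper_central: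
  assumes "N \<lhd> G"
  shows "upper_central G N i \<lhd> G"
  by (induction i) (use assms normal.normal_upper_central_step in auto)

text \<open>Every factor \<open>x\<close> moved past \<open>y\<close> leaves one factor
  \<open>w\<close> behind. The intended \<open>w\<close> is the commutator of \<open>x\<close> and
  \<open>y\<close>, and since it commutes with \<open>x\<close> these factors collect to a
  power.\<close>

lemma (in group) pow_commute_twisted:
  assumes "x \<in> carrier G" "y \<in> carrier G" "w \<in> carrier G"
    and "x \<otimes> y = w \<otimes> y \<otimes> x" "x \<otimes> w = w \<otimes> x"
  shows "x [^] (n::nat) \<otimes> y = w [^] n \<otimes> y \<otimes> x [^] n"
proof (induction n)
  case (Suc n)
  have xw: "x [^] n \<otimes> w = w \<otimes> x [^] n"
    using assms group_commutes_pow by blast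
  have "x [^] Suc n \<otimes> y = (x [^] n \<otimes> w) \<otimes> y \<otimes> x"
    using assms by (simp add: m_assoc)
  also have "\<dots> = w \<otimes> (x [^] n \<otimes> y) \<otimes> x"
    unfolding xw using assms by (simp add: m_assoc)
  also have "\<dots> = (w \<otimes> w [^] n) \<otimes> y \<otimes> (x [^] n \<otimes> x)"
    unfolding Suc.IH using assms by (simp add: m_assoc)
  also have "w \<otimes> w [^] n = w [^] Suc n"
    using assms nat_pow_Suc2 by simp
  finally show ?case by simp
qed (use assms in simp)

text \<open>The commutator of \<open>x\<close> and \<open>y\<close> is central modulo
  \<open>H\<close>, so its \<open>n\<close>-th power agrees modulo \<open>H\<close> with the
  commutator of \<open>x [^] n\<close> and \<open>y\<close>.\<close>

lemma (in normal) pow_commutator_in_iff: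
  fixes n :: nat
  assumes "x \<in> carrier G" "y \<in> carrier G"
    and central: "\<And>z. z \<in> carrier G \<Longrightarrow>
      (x \<otimes> y \<otimes> inv x \<otimes> inv y) \<otimes> z \<otimes> inv (x \<otimes> y \<otimes> inv x \<otimes> inv y) \<otimes> inv z \<in> H"
  shows "x [^] n \<otimes> y \<otimes> inv (x [^] n) \<otimes> inv y \<in> H \<longleftrightarrow> (x \<otimes> y \<otimes> inv x \<otimes> inv y) [^] n \<in> H"
proof -
  interpret Q: group "G Mod H" by (rule factorgroup_is_group)
  define f where "f x = H #> x" for x
  interpret f: group_hom G "G Mod H" f
    unfolding f_def by (rule group_hom_Mod)
  let ?w = "x \<otimes> y \<otimes> inv x \<otimes> inv y"
  have 1: "f x \<otimes>\<^bsub>G Mod H\<^esub> f ?w = f ?w \<otimes>\<^bsub>G Mod H\<^esub> f x"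
    using commutator_in_iff[of ?w x] central[of x] assms by (simp add: f_def)
  have "x \<otimes> y = ?w \<otimes> y \<otimes> x"
    using assms by (simp add: m_assoc)
  then have 2: "f x \<otimes>\<^bsub>G Mod H\<^esub> f y = f ?w \<otimes>\<^bsub>G Mod H\<^esub> f y \<otimes>\<^bsub>G Mod H\<^esub> f x"
    using assms by (metis f.hom_mult inv_closed m_closed)
  have 3: "f x [^]\<^bsub>G Mod H\<^esub> n \<otimes>\<^bsub>G Mod H\<^esub> f y =
      f ?w [^]\<^bsub>G Mod H\<^esub> n \<otimes>\<^bsub>G Mod H\<^esub> f y \<otimes>\<^bsub>G Mod H\<^esub> f x [^]\<^bsub>G Mod H\<^esub> n"
    by (intro Q.pow_commute_twisted[OF _ _ _ 2 1] f.hom_closed) (use assms(1,2) in auto)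
  then have "f (x [^] n) \<otimes>\<^bsub>G Mod H\<^esub> f y =
      f (?w [^] n) \<otimes>\<^bsub>G Mod H\<^esub> (f y \<otimes>\<^bsub>G Mod H\<^esub> f (x [^] n))"
    using assms by (simp add: f.hom_nat_pow Q.m_assoc del: mult_FactGroup)
  moreover have "x [^] n \<otimes> y \<otimes> inv (x [^] n) \<otimes> inv y \<in> H \<longleftrightarrow>
      f (x [^] n) \<otimes>\<^bsub>G Mod H\<^esub> f y = f y \<otimes>\<^bsub>G Mod H\<^esub> f (x [^] n)"
    using commutator_in_iff assms by (simp add: f_def)
  moreover have "?w [^] n \<in> H \<longleftrightarrow> f (?w [^] n) = \<one>\<^bsub>G Mod H\<^esub>"
    using rcos_eq_one_iff assms by (simp add: f_def)
  ultimately show ?thesis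
    using assms by (simp del: mult_FactGroup one_FactGroup)
qed

text \<open>For \<open>x\<close> in the next term of the series, \<open>n \<mapsto> [x\<^sup>n, y]\<close> is a homomorphism modulo the given one,
  so bounds on the torsion are inherited from each factor of the series by the next.\<close>

lemma (in group) upper_central_factor_exponent:
  fixes e n :: nat
  assumes "N \<lhd> G"
    and e: "\<And>x. x \<in> upper_central G N 1 \<Longrightarrow> \<exists>n::nat. 0 < n \<and> x [^] n \<in> N \<Longrightarrow> x [^] e \<in> N"
  shows "x \<in> upper_central G N (Suc i) \<Longrightarrow> 0 < n \<Longrightarrow> x [^] n \<in> upper_central G N i \<Longrightarrow>
    x [^] e \<in> upper_central G N i"
proof (induction i arbitrary: x)
  case 0
  then show ?case using e[of x] by auto
next
  case (Suc i)
  interpret Z: normal "upper_central G N i" G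
    using assms(1) by (rule normal_upper_central)
  have x: "x \<in> carrier G" using Suc.prems(1) by simp
  have "x [^] e \<otimes> y \<otimes> inv (x [^] e) \<otimes> inv y \<in> upper_central G N i" if y: "y \<in> carrier G" for y
  proof -
    let ?w = "x \<otimes> y \<otimes> inv x \<otimes> inv y"
    have w: "?w \<in> upper_central G N (Suc i)"
      using Suc.prems(1) y by (simp only: upper_central.simps(2) mem_Collect_eq) blast
    \<comment> \<open>With \<open>k = n\<close> this passes the torsion hypothesis from
      \<open>x\<close> to \<open>?w\<close>; with \<open>k = e\<close> it carries the bound for
      \<open>?w\<close> back to \<open>x\<close>.\<close>
    have iff: "x [^] k \<otimes> y \<otimes> inv (x [^] k) \<otimes> inv y \<in> upper_central G N i \<longleftrightarrow>
        ?w [^] k \<in> upper_central G N i" for k :: nat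
      by (rule Z.pow_commutator_in_iff) (use x y w in auto)
    have "?w [^] n \<in> upper_central G N i"
      using Suc.prems(3) y iff[of n] by (simp only: upper_central.simps(2) mem_Collect_eq)
    then show ?thesis
      using Suc.IH[OF w] Suc.prems(2) iff by blast
  qed
  then show ?case using x by simp
qed

text \<open>Raising to the power \<open>e\<close> moves a torsion element one term down the series,
  so \<open>c\<close> such steps lead from \<open>carrier G\<close> to \<open>N\<close>. Torsion
  modulo \<open>N\<close> is torsion modulo every term, because all terms contain
  \<open>N\<close>.\<close>

lemma (in group) torsion_exponent_if_central_torsion_exponent:
  fixes e n c :: nat
  assumes N: "N \<lhd> G"
    and e: "\<And>x. x \<in> upper_central G N 1 \<Longrightarrow> \<exists>n::nat. 0 < n \<and> x [^] n \<in> N \<Longrightarrow> x [^] e \<in> N"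
    and c: "upper_central G N c = carrier G"
    and x: "x \<in> carrier G" "0 < n" "x [^] n \<in> N"
  shows "x [^] (e ^ c) \<in> N"
proof -
  have Z: "subgroup (upper_central G N i) G" for i
    using normal_upper_central[OF N] normal_imp_subgroup by blast
  have N_le: "N \<subseteq> upper_central G N i" for i
  proof (induction i)
    case (Suc i)
    interpret N: normal N G by (rule N)
    have "a \<otimes> y \<otimes> inv a \<otimes> inv y \<in> N" if "a \<in> N" "y \<in> carrier G" for a y
      using that N.inv_op_closed2[of y "inv a"] by (simp add: m_assoc)
    then show ?case using Suc N.subset by auto
  qed simp
  have "x [^] (e ^ k) \<in> upper_central G N (c - k)" if "k \<le> c" for k
    using that
  proof (induction k)
    case (Suc k)
    have ck: "c - k = Suc (c - Suc k)" using Suc.prems by simp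
    have "(x [^] (e ^ k)) [^] n \<in> N"
      using subgroup.pow_dvd_closed[OF normal_imp_subgroup[OF N] is_group x(1,3), where n = "e ^ k * n"] x(1)
      by (simp add: nat_pow_pow)
    moreover have "x [^] (e ^ k) \<in> upper_central G N (Suc (c - Suc k))"
      using Suc unfolding ck by simp
    ultimately have "(x [^] (e ^ k)) [^] e \<in> upper_central G N (c - Suc k)"
      using upper_central_factor_exponent[OF N e] x(2) N_le by blast
    then show ?case using x(1) by (simp add: nat_pow_pow mult.commute)
  qed (use c x in simp)
  from this[of c] show ?thesis by simp
qed

text \<open>The lower central series of \<open>H\<close>, read backwards from its trivial term and
  pulled back along \<open>h\<close>, is a central series over the kernel, so it lies termwise
  inside \<open>upper_central\<close>.\<close>

lemma (in group_hom) upper_central_kernel_eq_carrier: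
  assumes "lower_central H c = {\<one>\<^bsub>H\<^esub>}"
  shows "upper_central G (kernel G H h) c = carrier G"
proof -
  have "x \<in> upper_central G (kernel G H h) i"
    if "i \<le> c" "x \<in> carrier G" "h x \<in> lower_central H (c - i)" for i x
    using that
  proof (induction i arbitrary: x)
    case 0
    then show ?case using assms by (simp add: kernel_def)
  next
    case (Suc i)
    have ci: "c - i = Suc (c - Suc i)" using Suc.prems by simp
    have "x \<otimes> y \<otimes> inv x \<otimes> inv y \<in> upper_central G (kernel G H h) i" if y: "y \<in> carrier G" for y
    proof -
      have "h (x \<otimes> y \<otimes> inv x \<otimes> inv y) \<in> lower_central H (c - i)"
        unfolding ci lower_central.simps
        using Suc.prems y by (intro generate.incl CollectI exI[of _ "h x"] exI[of _ "h y"]) auto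
      then show ?thesis using Suc y by simp
    qed
    then show ?case using Suc.prems by simp
  qed
  from this[of c] have "carrier G \<subseteq> upper_central G (kernel G H h) c"
    by auto
  then show ?thesis
    using subgroup.subset[OF normal_imp_subgroup[OF G.normal_upper_central[OF normal_kernel]]]
    by blast
qed

text \<open>Cauchy's theorem: Sylow's theorem with exponent 1 gives a subgroup of order
  \<open>p\<close>, and any nontrivial element of it will do.\<close>

lemma (in group) exists_pow_eq_one_of_prime_dvd_order:
  assumes "prime p" "p dvd order G" "finite (carrier G)"
  shows "\<exists>x\<in>carrier G. x \<noteq> \<one> \<and> x [^] p = \<one>"
proof -
  obtain q where "order G = p ^ 1 * q" using assms(2) by auto
  then obtain P where P: "subgroup P G" "card P = p"
    using sylow_thm[OF assms(1) is_group _ assms(3), of 1] by auto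
  have "P \<noteq> {\<one>}" using P assms(1) by force
  then obtain x where x: "x \<in> P" "x \<noteq> \<one>"
    using P(1) subgroup.one_closed by blast
  have "x [^]\<^bsub>G\<lparr>carrier := P\<rparr>\<^esub> order (G\<lparr>carrier := P\<rparr>) = \<one>"
    using group.pow_order_eq_1[OF subgroup.subgroup_is_group[OF P(1) is_group], of x] x(1) by simp
  then have "x [^] p = \<one>"
    unfolding order_def nat_pow_consistent[symmetric] using P(2) by simp
  with x(2) subgroup.mem_carrier[OF P(1) x(1)] show ?thesis by blast
qed

lemma (in normal) pow_in_cong:
  fixes n :: nat
  assumes "x \<in> carrier G" "y \<in> carrier G" "H #> x = H #> y"
  shows "x [^] n \<in> H \<longleftrightarrow> y [^] n \<in> H"
  using assms FactGroup_pow[of x n] FactGroup_pow[of y n] rcos_eq_one_iff[of "x [^] n"]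
    rcos_eq_one_iff[of "y [^] n"] by simp

lemma (in normal) rcos_mult_eq:
  assumes "x \<in> H" "y \<in> carrier G"
  shows "H #> (x \<otimes> y) = H #> y"
  using assms by (simp add: rcos_eq_iff m_assoc)

text \<open>Modulo \<open>H\<close> the two elements commute, so the power distributes over the
  product and the factor \<open>y [^] n\<close> vanishes.\<close>

lemma (in normal) pow_mult_in_iff:
  fixes n :: nat
  assumes "x \<in> carrier G" "y \<in> carrier G" "x \<otimes> y \<otimes> inv x \<otimes> inv y \<in> H" "y [^] n \<in> H"
  shows "(x \<otimes> y) [^] n \<in> H \<longleftrightarrow> x [^] n \<in> H"
proof -
  interpret Q: group "G Mod H" by (rule factorgroup_is_group)
  define f where "f x = H #> x" for x
  interpret f: group_hom G "G Mod H" f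
    unfolding f_def by (rule group_hom_Mod)
  have one: "f u = \<one>\<^bsub>G Mod H\<^esub> \<longleftrightarrow> u \<in> H" if "u \<in> carrier G" for u
    using rcos_eq_one_iff that by (simp add: f_def)
  have comm: "f x \<otimes>\<^bsub>G Mod H\<^esub> f y = f y \<otimes>\<^bsub>G Mod H\<^esub> f x"
    using commutator_in_iff assms by (simp add: f_def)
  have "f ((x \<otimes> y) [^] n) = (f x \<otimes>\<^bsub>G Mod H\<^esub> f y) [^]\<^bsub>G Mod H\<^esub> n"
    unfolding f.hom_nat_pow[OF m_closed[OF assms(1,2)]] f.hom_mult[OF assms(1,2)] ..
  also have "\<dots> = f x [^]\<^bsub>G Mod H\<^esub> n \<otimes>\<^bsub>G Mod H\<^esub> f y [^]\<^bsub>G Mod H\<^esub> n"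
    by (rule Q.pow_mult_distrib[OF comm]) (use assms in auto)
  also have "\<dots> = f (x [^] n) \<otimes>\<^bsub>G Mod H\<^esub> f (y [^] n)"
    using assms by (simp only: f.hom_nat_pow)
  also have "f (y [^] n) = \<one>\<^bsub>G Mod H\<^esub>"
    using one assms by simp
  also have "f (x [^] n) \<otimes>\<^bsub>G Mod H\<^esub> \<one>\<^bsub>G Mod H\<^esub> = f (x [^] n)"
    using assms by (intro Q.r_one f.hom_closed nat_pow_closed)
  finally show ?thesis
    using one assms by (metis m_closed nat_pow_closed)
qed

section \<open>Separating elements of profinite groups by powers\<close>

lemma (in topological_group) continuous_map_right_mult:
  assumes "a \<in> carrier G"
  shows "continuous_map \<tau> \<tau> (\<lambda>x. x \<otimes> a)"
proof -
  have "continuous_map \<tau> (prod_topology \<tau> \<tau>) (\<lambda>x. (x, a))"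
    using assms topspace by (auto intro!: continuous_map_pairedI)
  from continuous_map_compose[OF this continuous_mult] show ?thesis
    by (simp add: o_def)
qed

lemma (in topological_group) openin_rcos:
  assumes "openin \<tau> H" "subgroup H G" "a \<in> carrier G"
  shows "openin \<tau> (H #> a)"
proof -
  have "H #> a = {x \<in> topspace \<tau>. x \<otimes> inv a \<in> H}"
    using assms subgroup.rcos_module[OF assms(2) is_group assms(3)]
      subgroup.elemrcos_carrier[OF assms(2) is_group assms(3)] topspace by blast
  then show ?thesis
    using openin_continuous_map_preimage[OF continuous_map_right_mult assms(1)] assms(3) by simp
qed

text \<open>The complement is the union of the other cosets, which are open.\<close>

lemma (in topological_group) closedin_rcos:
  assumes "openin \<tau> H" "subgroup H G" "a \<in> carrier G"
  shows "closedin \<tau> (H #> a)"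
proof -
  have "topspace \<tau> - (H #> a) = \<Union>{H #> b | b. b \<in> carrier G \<and> b \<notin> H #> a}" (is "_ = ?U")
  proof
    show "topspace \<tau> - (H #> a) \<subseteq> ?U"
      using rcos_self[OF _ assms(2)] topspace by blast
    show "?U \<subseteq> topspace \<tau> - (H #> a)"
    proof
      fix x assume "x \<in> ?U"
      then obtain b where b: "b \<in> carrier G" "b \<notin> H #> a" "x \<in> H #> b" by blast
      then have "H #> x = H #> b"
        using repr_independence assms by metis
      then have "x \<notin> H #> a"
        using b repr_independence[OF _ assms(3,2)] rcos_self[OF b(1) assms(2)] by blast
      then show "x \<in> topspace \<tau> - (H #> a)"
        using b subgroup.elemrcos_carrier[OF assms(2) is_group] topspace by blast
    qed
  qed
  moreover have "openin \<tau> ?U"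
    using openin_rcos assms by auto
  moreover have "H #> a \<subseteq> topspace \<tau>"
    using assms topspace r_coset_subset_G subgroup.subset by blast
  ultimately show ?thesis
    by (simp add: closedin_def)
qed

text \<open>The cosets are an open partition, and a subcover of a partition into nonempty sets omits
  none of them.\<close>

lemma (in topological_group) finite_index_of_open_subgroup:
  assumes "compact_space \<tau>" "openin \<tau> H" "subgroup H G"
  shows "finite (rcosets H)"
proof -
  have "\<Union>(rcosets H) = topspace \<tau>"
    using rcosets_part_G assms(3) topspace by simp
  then obtain F where F: "finite F" "F \<subseteq> rcosets H" "topspace \<tau> \<subseteq> \<Union>F"
    using assms openin_rcos unfolding compact_space_alt
    by (smt (verit) RCOSETS_def UN_E singletonD subset_refl)
  have "rcosets H \<subseteq> F"
  proof
    fix C assume C: "C \<in> rcosets H"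
    then obtain x where x: "x \<in> C"
      using subgroup.rcosets_non_empty[OF assms(3)] by blast
    then have "x \<in> \<Union>F"
      using C F(3) \<open>\<Union>(rcosets H) = topspace \<tau>\<close> by blast
    then obtain D where "D \<in> F" "x \<in> D" by blast
    then have "C = D"
      using x C F(2) rcos_disjoint[OF assms(3)] unfolding pairwise_def disjnt_def by blast
    then show "C \<in> F" using \<open>D \<in> F\<close> by simp
  qed
  then show ?thesis using F(1) finite_subset by blast
qed

text \<open>The index type \<open>nat set\<close> has the cardinality of the continuum. The
  separating conditions are invariant under conjugation when \<open>K l\<close> is normal, so they
  can be read off from isometry types.\<close>

definition power_separated ::
  "('g, 'b) monoid_scheme \<Rightarrow> (nat \<Rightarrow> 'g set) \<Rightarrow> (nat set \<Rightarrow> 'g) \<Rightarrow> bool" where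
  "power_separated G K a \<longleftrightarrow> range a \<subseteq> carrier G \<and>
     (\<forall>A B. A \<noteq> B \<longrightarrow> (\<exists>l e::nat. (a A [^]\<^bsub>G\<^esub> e \<in> K l) \<noteq> (a B [^]\<^bsub>G\<^esub> e \<in> K l)))"

locale filtered_profinite_group = profinite_group G \<tau>
  for G :: "('g, 'b) monoid_scheme" (structure) and \<tau> +
  fixes K :: "nat \<Rightarrow> 'g set"
  assumes normal_K: "K l \<lhd> G"
    and open_K: "openin \<tau> (K l)"
    and decseq_K: "decseq K"
    and Inter_K: "(\<Inter>l. K l) = {\<one>}"
begin

lemma subgroup_K: "subgroup (K l) G"
  using normal_K by (rule normal_imp_subgroup)

lemma K_antimono: "l \<le> l' \<Longrightarrow> K l' \<subseteq> K l"
  using decseq_K by (auto simp: decseq_def)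

lemma finite_Mod_K: "finite (carrier (G Mod K l))"
  using finite_index_of_open_subgroup[OF compact open_K subgroup_K] by (simp add: FactGroup_def)

lemma order_Mod_K_pos: "0 < order (G Mod K l)"
  using monoid.order_gt_0_iff_finite[OF group.is_monoid[OF normal.factorgroup_is_group[OF normal_K]]]
    finite_Mod_K by blast

text \<open>Thus \<open>K\<close> is a neighbourhood base at \<one>. Otherwise the decreasing
  nonempty closed sets \<open>K n - U\<close> would by compactness have a common point, which could
  only be \<one>.\<close>

lemma K_subset_of_open:
  assumes "openin \<tau> U" "\<one> \<in> U"
  shows "\<exists>l'\<ge>l. K l' \<subseteq> U"
proof (rule ccontr)
  assume "\<not> (\<exists>l'\<ge>l. K l' \<subseteq> U)"
  then have ne: "K n - U \<noteq> {}" for n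
    using K_antimono[of n "max l n"] by (meson Diff_eq_empty_iff max.cobounded1 max.cobounded2 subset_trans)
  have "closedin \<tau> (K n - U)" for n
  proof -
    have "K n #> \<one> = K n"
      using coset_mult_one subgroup.subset[OF subgroup_K] by blast
    with closedin_rcos[OF open_K subgroup_K one_closed, of n] assms(1) show ?thesis
      by (simp add: closedin_diff)
  qed
  moreover have "decseq (\<lambda>n. K n - U)"
    using K_antimono by (fastforce simp: decseq_def)
  ultimately have "(\<Inter>n. K n - U) \<noteq> {}"
    using compact_space_imp_nest[OF compact, of "\<lambda>n. K n - U"] ne by blast
  then show False using Inter_K assms(2) by blast
qed

text \<open>Approximations in \<open>S\<close> are refined along a binary tree, one binary decision
  per stage, with \<open>ext\<close> applied to the finitely many current values. The limits exist
  by compactness and are only claimed to lie in \<open>carrier G\<close>.\<close>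

lemma exists_separated_family:
  assumes "S \<subseteq> carrier G" "S \<noteq> {}"
    and ext: "\<And>l F. finite F \<Longrightarrow> F \<subseteq> S \<Longrightarrow> \<exists>l'\<ge>l. \<exists>e::nat. \<forall>g\<in>F.
      (\<exists>h\<in>S. K l #> h = K l #> g \<and> h [^] e \<in> K l') \<and>
      (\<exists>h\<in>S. K l #> h = K l #> g \<and> h [^] e \<notin> K l')"
  shows "\<exists>a. power_separated G K a"
proof -
  \<comment> \<open>A state consists of the current approximation for every \<open>A\<close> and the
    depth up to which it is final. Finiteness of the range is what makes \<open>ext\<close>
    applicable.\<close>
  define P :: "nat \<Rightarrow> (nat set \<Rightarrow> 'g) \<times> nat \<Rightarrow> bool"
    where "P n s \<longleftrightarrow> finite (range (fst s)) \<and> range (fst s) \<subseteq> S" for n s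
  \<comment> \<open>Stage \<open>n\<close> encodes whether \<open>n \<in> A\<close>, by an exponent
    \<open>e\<close> common to all \<open>A\<close>, and changes nothing modulo the old
    depth.\<close>
  define Q :: "nat \<Rightarrow> (nat set \<Rightarrow> 'g) \<times> nat \<Rightarrow> (nat set \<Rightarrow> 'g) \<times> nat \<Rightarrow> bool"
    where "Q n s s' \<longleftrightarrow> snd s \<le> snd s' \<and> (\<forall>A. K (snd s) #> fst s' A = K (snd s) #> fst s A) \<and>
      (\<exists>e::nat. \<forall>A. fst s' A [^] e \<in> K (snd s') \<longleftrightarrow> n \<notin> A)" for n s s'
  have "\<exists>s. \<forall>n. P n (s n) \<and> Q n (s n) (s (Suc n))"
  proof (rule dependent_nat_choice)
    obtain x where "x \<in> S" using assms(2) by blast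
    then have "P 0 (\<lambda>_. x, 0)" by (simp add: P_def)
    then show "\<exists>s. P 0 s" ..
  next
    fix s n assume s: "P n s"
    obtain f l where fl: "s = (f, l)" by fastforce
    have f: "finite (range f)" "range f \<subseteq> S" using s by (auto simp: P_def fl)
    from ext[OF f, of l] obtain l' and e :: nat where l': "l \<le> l'" and
      *: "\<forall>g\<in>range f. (\<exists>h\<in>S. K l #> h = K l #> g \<and> h [^] e \<in> K l') \<and>
        (\<exists>h\<in>S. K l #> h = K l #> g \<and> h [^] e \<notin> K l')"
      by blast
    then obtain h0 h1
      where h0: "\<And>g. g \<in> range f \<Longrightarrow> h0 g \<in> S \<and> K l #> h0 g = K l #> g \<and> h0 g [^] e \<in> K l'"
        and h1: "\<And>g. g \<in> range f \<Longrightarrow> h1 g \<in> S \<and> K l #> h1 g = K l #> g \<and> h1 g [^] e \<notin> K l'"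
      by metis
    define f' where "f' A = (if n \<in> A then h1 (f A) else h0 (f A))" for A
    have "range f' \<subseteq> h0 ` range f \<union> h1 ` range f"
      by (auto simp: f'_def)
    then have "finite (range f')"
      using f(1) finite_subset by blast
    moreover have "range f' \<subseteq> S"
      using h0 h1 by (auto simp: f'_def)
    ultimately have "P (Suc n) (f', l')"
      by (simp add: P_def)
    moreover have "Q n s (f', l')"
      using h0 h1 l' unfolding Q_def fl by (auto simp: f'_def intro!: exI[of _ e])
    ultimately show "\<exists>s'. P (Suc n) s' \<and> Q n s s'" by blast
  qed
  then obtain s where s: "\<And>n. P n (s n)" "\<And>n. Q n (s n) (s (Suc n))"
    by blast
  define f l where "f n = fst (s n)" and "l n = snd (s n)" for n
  have f: "f n A \<in> carrier G" for n A
    using s(1)[of n] assms(1) by (auto simp: P_def f_def)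
  have l: "l n \<le> l (Suc n)" and f_Suc: "K (l n) #> f (Suc n) A = K (l n) #> f n A" for n A
    using s(2)[of n] by (auto simp: Q_def f_def l_def)
  have "\<exists>e::nat. \<forall>A. f (Suc n) A [^] e \<in> K (l (Suc n)) \<longleftrightarrow> n \<notin> A" for n
    using s(2)[of n] by (auto simp: Q_def f_def l_def)
  then obtain e :: "nat \<Rightarrow> nat" where e: "f (Suc n) A [^] e n \<in> K (l (Suc n)) \<longleftrightarrow> n \<notin> A" for n A
    by metis
  \<comment> \<open>The cosets of the approximations are closed and nested, so they have a common
    point.\<close>
  have "\<exists>x. \<forall>n. x \<in> K (l n) #> f n A" for A
  proof -
    have "(\<Inter>n. K (l n) #> f n A) \<noteq> {}"
    proof (rule compact_space_imp_nest[OF compact])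
      show "closedin \<tau> (K (l n) #> f n A)" for n
        using closedin_rcos open_K subgroup_K f by blast
      show "K (l n) #> f n A \<noteq> {}" for n
        using rcos_self[OF f subgroup_K] by blast
      have "K (l (Suc n)) #> f (Suc n) A \<subseteq> K (l n) #> f (Suc n) A" for n
        using K_antimono[OF l] by (auto simp: r_coset_def)
      then show "decseq (\<lambda>n. K (l n) #> f n A)"
        using f_Suc by (simp add: decseq_Suc_iff)
    qed
    then show ?thesis by blast
  qed
  then obtain a where a: "a A \<in> K (l n) #> f n A" for A n
    by metis
  have carr: "a A \<in> carrier G" for A
    using a[of A 0] f subgroup.elemrcos_carrier[OF subgroup_K is_group] by blast
  \<comment> \<open>The limit and \<open>f (Suc n) A\<close> agree modulo
    \<open>K (l (Suc n))\<close>, so the decision made at stage \<open>n\<close> survives.\<close>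
  have "a A [^] e n \<in> K (l (Suc n)) \<longleftrightarrow> n \<notin> A" for A n
    using repr_independence[OF a[of A "Suc n"] f subgroup_K]
      normal.pow_in_cong[OF normal_K f carr] e by blast
  then have "\<exists>l e::nat. (a A [^] e \<in> K l) \<noteq> (a B [^] e \<in> K l)" if "A \<noteq> B" for A B
    using that by blast
  with carr have "power_separated G K a"
    by (auto simp: power_separated_def)
  then show ?thesis by blast
qed

lemma separated_family_of_unbounded_torsion:
  assumes "nilpotent_group G" "\<not> finite_exponent G (periodic_part G)"
  shows "\<exists>a. power_separated G K a"
proof -
  let ?Z = "upper_central G {\<one>} 1"
  \<comment> \<open>\<open>?Z\<close> is the center of \<open>G\<close>, so \<open>S\<close> is the
    torsion of the center.\<close>
  define S where "S = {x \<in> ?Z. \<exists>n::nat. 0 < n \<and> x [^] n = \<one>}"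
  have Z: "subgroup ?Z G"
    using normal_upper_central[OF one_is_normal] normal_imp_subgroup by blast
  have SG: "S \<subseteq> carrier G"
    using Z subgroup.subset by (auto simp: S_def)
  have comm: "x \<otimes> y = y \<otimes> x" if "x \<in> S" "y \<in> carrier G" for x y
  proof -
    have x: "x \<in> carrier G" "x \<otimes> y \<otimes> inv x \<otimes> inv y = \<one>"
      using that by (auto simp: S_def)
    then have "x \<otimes> y \<otimes> inv (y \<otimes> x) = \<one>"
      using that by (simp add: inv_mult_group m_assoc)
    then show ?thesis
      using x that inv_equality by (metis inv_closed inv_inv m_closed)
  qed
  have unbounded: "\<exists>t\<in>S. t [^] e \<noteq> \<one>" if "0 < e" for e :: nat
  proof (rule ccontr)
    assume "\<not> (\<exists>t\<in>S. t [^] e \<noteq> \<one>)"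
    then have e: "x [^] e \<in> {\<one>}" if "x \<in> ?Z" "\<exists>n::nat. 0 < n \<and> x [^] n \<in> {\<one>}" for x
      using that unfolding S_def by blast
    obtain c where c: "lower_central G c = {\<one>}"
      using assms(1) by (auto simp: nilpotent_group_def)
    \<comment> \<open>The comparison of the two central series is applied to the identity map, whose
      kernel is trivial.\<close>
    have id: "group_hom G G (\<lambda>x. x)"
      by (simp add: group_hom_def group_hom_axioms_def is_group hom_def)
    have "kernel G G (\<lambda>x. x) = {\<one>}" unfolding kernel_def by blast
    then have "upper_central G {\<one>} c = carrier G"
      using group_hom.upper_central_kernel_eq_carrier[OF id c] by simp
    then have "x [^] (e ^ c) = \<one>" if "x \<in> periodic_part G" for x
      using torsion_exponent_if_central_torsion_exponent[OF one_is_normal e] that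
      by (auto simp: periodic_part_def)
    moreover have "0 < e ^ c" using that by simp
    ultimately show False
      using assms(2) unfolding finite_exponent_def by blast
  qed
  show ?thesis
  proof (rule exists_separated_family[OF SG])
    show "S \<noteq> {}" using unbounded[of 1] by auto
  next
    fix l F assume F: "finite F" "F \<subseteq> S"
    interpret Kl: normal "K l" G by (rule normal_K)
    have "\<forall>g\<in>F. \<exists>n::nat. 0 < n \<and> g [^] n = \<one>"
      using F(2) by (auto simp: S_def)
    then obtain n :: "'g \<Rightarrow> nat" where n: "\<And>g. g \<in> F \<Longrightarrow> 0 < n g \<and> g [^] n g = \<one>"
      by metis
    \<comment> \<open>A common exponent of the elements of \<open>F\<close>: they satisfy the first
      alternative unchanged.\<close>
    define e where "e = prod n F"
    have e: "0 < e" using n by (auto simp: e_def intro: prod_pos)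
    have Fe: "g [^] e = \<one>" if "g \<in> F" for g
    proof -
      have "n g dvd e" using that F(1) by (auto simp: e_def intro: dvd_prodI)
      then obtain k where "e = n g * k" by blast
      moreover have "g \<in> carrier G" using that F(2) SG by blast
      ultimately show ?thesis
        using n[OF that] by (metis nat_pow_one nat_pow_pow)
    qed
    \<comment> \<open>The factor \<open>order (G Mod K l)\<close> will push a power \<open>u\<close>
      of \<open>t\<close> into \<open>K l\<close>; the factor \<open>e\<close> ensures that
      \<open>u [^] e\<close> is still nontrivial.\<close>
    obtain t where t: "t \<in> S" "t [^] (order (G Mod K l) * e) \<noteq> \<one>"
      using unbounded[of "order (G Mod K l) * e"] e order_Mod_K_pos by auto
    have tG: "t \<in> carrier G" using t(1) SG by blast
    define u where "u = t [^] order (G Mod K l)"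
    have uK: "u \<in> K l" unfolding u_def using tG by (rule Kl.pow_index_in)
    then have uG: "u \<in> carrier G" using Kl.subset by blast
    have ue: "u [^] e \<noteq> \<one>" using t tG by (simp add: u_def nat_pow_pow)
    have S_mult: "x \<otimes> y \<in> S" if xy: "x \<in> S" "y \<in> S" for x y
    proof -
      obtain i j :: nat where ij: "0 < i" "0 < j" "x [^] i = \<one>" "y [^] j = \<one>"
        using xy by (auto simp: S_def)
      have G: "x \<in> carrier G" "y \<in> carrier G" using xy SG by auto
      then have "(x \<otimes> y) [^] (i * j) = (x [^] i) [^] j \<otimes> (y [^] j) [^] i"
        using pow_mult_distrib[OF comm, of x y "i * j"] xy(1) by (simp add: nat_pow_pow mult.commute)
      then have "(x \<otimes> y) [^] (i * j) = \<one>" using ij by simp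
      moreover have "0 < i * j" using ij by simp
      ultimately show ?thesis
        using xy subgroup.m_closed[OF Z, of x y] unfolding S_def by blast
    qed
    have "t [^] k \<in> S" if "0 < k" for k :: nat
      using that
    proof (induction k rule: nat_induct_non_zero)
      case 1
      then show ?case using t(1) tG by simp
    next
      case (Suc k)
      then show ?case using S_mult t(1) by simp
    qed
    then have uS: "u \<in> S" unfolding u_def using order_Mod_K_pos by blast
    have "\<exists>l'. u [^] e \<notin> K l'" using ue Inter_K by blast
    then obtain l' where l': "l \<le> l'" "u [^] e \<notin> K l'"
      using K_antimono by (metis max.cobounded1 max.cobounded2 subsetD)
    interpret Kl': normal "K l'" G by (rule normal_K)
    have "\<forall>g\<in>F. (\<exists>h\<in>S. K l #> h = K l #> g \<and> h [^] e \<in> K l') \<and>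
      (\<exists>h\<in>S. K l #> h = K l #> g \<and> h [^] e \<notin> K l')"
    proof (intro ballI conjI)
      fix g assume g: "g \<in> F"
      then have gS: "g \<in> S" and gG: "g \<in> carrier G" using F(2) SG by auto
      show "\<exists>h\<in>S. K l #> h = K l #> g \<and> h [^] e \<in> K l'"
        using gS Fe[OF g] Kl'.one_closed by auto
      \<comment> \<open>As \<open>u\<close> is central and \<open>g [^] e = \<one>\<close>, this
        power equals \<open>u [^] e\<close>.\<close>
      have "(u \<otimes> g) [^] e \<notin> K l'"
        using Fe[OF g] l'(2) pow_mult_distrib[OF comm[OF uS gG] uG gG, of e] uG by simp
      then show "\<exists>h\<in>S. K l #> h = K l #> g \<and> h [^] e \<notin> K l'"
        using S_mult[OF uS gS] Kl.rcos_mult_eq[OF uK gG] by blast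
    qed
    with l'(1) show "\<exists>l'\<ge>l. \<exists>e::nat. \<forall>g\<in>F.
      (\<exists>h\<in>S. K l #> h = K l #> g \<and> h [^] e \<in> K l') \<and>
      (\<exists>h\<in>S. K l #> h = K l #> g \<and> h [^] e \<notin> K l')"
      by blast
  qed
qed

text \<open>Modulo \<open>K l'\<close>, each \<open>g\<close> is first replaced by an element
  \<open>h\<close> of order prime to \<open>p\<close> and then multiplied by a central
  \<open>p\<close>-element \<open>u\<close>. Neither change is visible modulo \<open>K l\<close>,
  whose index is prime to \<open>p\<close>.\<close>

lemma separated_family_of_infinitely_many_primes:
  assumes "pronilpotent_group G \<tau>" "infinite (order_primes G \<tau>)"
  shows "\<exists>a. power_separated G K a"
proof (rule exists_separated_family)
  show "carrier G \<noteq> {}" by blast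
next
  fix l F assume F: "finite F" "F \<subseteq> carrier G"
  interpret Kl: normal "K l" G by (rule normal_K)
  define M where "M = order (G Mod K l)"
  have M: "0 < M" unfolding M_def by (rule order_Mod_K_pos)
  have powM: "x [^] M \<in> K l" if "x \<in> carrier G" for x
    unfolding M_def using that by (rule Kl.pow_index_in)
  have "finite {p. p dvd M}" using M by simp
  then have "\<not> order_primes G \<tau> \<subseteq> {p. p dvd M}"
    using assms(2) finite_subset[of "order_primes G \<tau>"] by blast
  then obtain p where "p \<in> order_primes G \<tau>" and pM: "\<not> p dvd M"
    by blast
  then obtain N where p: "prime p" and N: "N \<lhd> G" "openin \<tau> N" "finite (carrier (G Mod N))"
    and pN: "p dvd order (G Mod N)"
    by (auto simp: order_primes_def finite_quotient_kernels_def)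
  interpret N: normal N G by (rule N)
  obtain C where "C \<in> carrier (G Mod N)" "C \<noteq> \<one>\<^bsub>G Mod N\<^esub>" "C [^]\<^bsub>G Mod N\<^esub> p = \<one>\<^bsub>G Mod N\<^esub>"
    using group.exists_pow_eq_one_of_prime_dvd_order[OF N.factorgroup_is_group p pN N(3)] by blast
  moreover from this(1) obtain x where x: "x \<in> carrier G" "C = N #> x"
    by (auto simp: carrier_FactGroup)
  ultimately have x: "x \<in> carrier G" "x \<notin> N" "x [^] p \<in> N"
    using N.rcos_eq_one_iff N.FactGroup_pow by auto
  obtain l' where l': "l \<le> l'" "K l' \<subseteq> N"
    using K_subset_of_open[OF N(2) N.one_closed] by blast
  interpret Kl': normal "K l'" G by (rule normal_K)
  define M' where "M' = order (G Mod K l')"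
  have M': "0 < M'" unfolding M'_def by (rule order_Mod_K_pos)
  have powM': "y [^] M' \<in> K l'" if "y \<in> carrier G" for y
    unfolding M'_def using that by (rule Kl'.pow_index_in)
  \<comment> \<open>The \<open>p\<close>-part and the prime-to-\<open>p\<close> part of the index of
    \<open>K l'\<close>; \<open>m\<close> will be the separating exponent.\<close>
  obtain k m where km: "M' = p ^ k * m" "\<not> p dvd m"
    using multiplicity_decompose'[of M' p] M' p by (metis not_prime_unit gr_implies_not0)
  have cop: "coprime m (p ^ k)" "coprime M (p ^ k)" and copc: "coprime (m ^ c) p" for c
    using km(2) pM prime_imp_coprime[OF p] by (auto simp: coprime_commute[of _ p])
  have "nilpotent_group (G Mod K l')"
    using assms(1) normal_K open_K finite_Mod_K
    by (auto simp: pronilpotent_group_def finite_quotient_kernels_def)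
  then obtain c where "lower_central (G Mod K l') c = {\<one>\<^bsub>G Mod K l'\<^esub>}"
    by (auto simp: nilpotent_group_def)
  then have c: "upper_central G (K l') c = carrier G"
    using group_hom.upper_central_kernel_eq_carrier[OF Kl'.group_hom_Mod] Kl'.kernel_Mod by metis
  \<comment> \<open>If \<open>m\<close> killed the center of the nilpotent quotient by
    \<open>K l'\<close>, then \<open>m ^ c\<close> would kill the whole quotient, contradicting
    \<open>x\<close>, which has order \<open>p\<close> modulo the larger subgroup
    \<open>N\<close>.\<close>
  have "\<exists>z\<in>upper_central G (K l') 1. z [^] m \<notin> K l'"
  proof (rule ccontr)
    assume "\<not> (\<exists>z\<in>upper_central G (K l') 1. z [^] m \<notin> K l')"
    then have "x [^] (m ^ c) \<in> K l'"
      using torsion_exponent_if_central_torsion_exponent[OF normal_K _ c x(1) M' powM'[OF x(1)]]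
      by blast
    then show False
      using N.pow_coprime_closed[OF is_group x(1) _ x(3) copc] l'(2) x(2) by blast
  qed
  then obtain z where z: "z \<in> carrier G" "\<And>y. y \<in> carrier G \<Longrightarrow> z \<otimes> y \<otimes> inv z \<otimes> inv y \<in> K l'"
    and zm: "z [^] m \<notin> K l'"
    by auto
  \<comment> \<open>Modulo \<open>K l'\<close> this is a central element killed by
    \<open>p ^ k\<close>. Since \<open>M\<close> kills it modulo \<open>K l\<close> and is prime to
    \<open>p\<close>, it lies in \<open>K l\<close>.\<close>
  define u where "u = z [^] m"
  have uG: "u \<in> carrier G" using z(1) by (simp add: u_def)
  have upk: "u [^] (p ^ k) \<in> K l'"
    using powM'[OF z(1)] z(1) by (simp add: u_def nat_pow_pow km(1) mult.commute)
  have uK: "u \<in> K l"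
    using Kl.pow_coprime_closed[OF is_group uG powM[OF uG] _ cop(2)] upk K_antimono[OF l'(1)] by blast
  \<comment> \<open>Since \<open>m\<close> is prime to \<open>p ^ k\<close>, membership would put
    \<open>u\<close> itself, that is \<open>z [^] m\<close>, into \<open>K l'\<close>.\<close>
  have um: "u [^] m \<notin> K l'"
    using Kl'.pow_coprime_closed[OF is_group uG _ upk cop(1)] zm by (auto simp: u_def)
  have u_central: "u \<otimes> y \<otimes> inv u \<otimes> inv y \<in> K l'" if "y \<in> carrier G" for y
  proof -
    have "u \<in> upper_central G (K l') 1"
      unfolding u_def
      by (rule subgroup.pow_dvd_closed[OF normal_imp_subgroup[OF normal_upper_central[OF normal_K]]
            is_group z(1) _ one_dvd]) (use z in simp)
    then show ?thesis using that by simp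
  qed
  \<comment> \<open>The exponent \<open>p ^ k * i\<close> is 1 modulo \<open>M\<close>: raising to
    it preserves cosets of \<open>K l\<close> but removes the \<open>p\<close>-part modulo
    \<open>K l'\<close>.\<close>
  obtain i j where ij: "p ^ k * i = M * j + 1"
    using bezout_nat[of "p ^ k" M] p cop(2) by (metis coprime_iff_gcd_eq_1 gcd.commute not_prime_0 power_not_zero)
  have "\<forall>g\<in>F. (\<exists>h\<in>carrier G. K l #> h = K l #> g \<and> h [^] m \<in> K l') \<and>
    (\<exists>h\<in>carrier G. K l #> h = K l #> g \<and> h [^] m \<notin> K l')"
  proof (intro ballI conjI)
    fix g assume "g \<in> F"
    then have g: "g \<in> carrier G" using F by blast
    define h where "h = g [^] (p ^ k * i)"
    have hG: "h \<in> carrier G" using g by (simp add: h_def)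
    have "h = (g [^] M) [^] j \<otimes> g"
      using g by (simp add: h_def ij nat_pow_pow)
    moreover have "(g [^] M) [^] j \<in> K l"
      using Kl.pow_dvd_closed[OF is_group _ _ one_dvd, of "g [^] M" j] powM[OF g] g by simp
    ultimately have hK: "K l #> h = K l #> g"
      using Kl.rcos_mult_eq g by simp
    have hm: "h [^] m \<in> K l'"
      using Kl'.pow_dvd_closed[OF is_group g powM'[OF g], of "p ^ k * i * m"] g km(1)
      by (simp add: h_def nat_pow_pow)
    show "\<exists>h\<in>carrier G. K l #> h = K l #> g \<and> h [^] m \<in> K l'"
      using hG hK hm by blast
    have "(u \<otimes> h) [^] m \<notin> K l'"
      using Kl'.pow_mult_in_iff[OF uG hG u_central[OF hG] hm] um by simp
    moreover have "K l #> (u \<otimes> h) = K l #> g"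
      using Kl.rcos_mult_eq[OF uK hG] hK by simp
    ultimately show "\<exists>h\<in>carrier G. K l #> h = K l #> g \<and> h [^] m \<notin> K l'"
      using uG hG by blast
  qed
  with l'(1) show "\<exists>l'\<ge>l. \<exists>e::nat. \<forall>g\<in>F.
    (\<exists>h\<in>carrier G. K l #> h = K l #> g \<and> h [^] e \<in> K l') \<and>
    (\<exists>h\<in>carrier G. K l #> h = K l #> g \<and> h [^] e \<notin> K l')"
    by blast
qed simp

end

section \<open>Ball stabilisers in the isometry group\<close>

lemma (in group_hom) normal_vimage:
  assumes "N \<lhd> H"
  shows "{x \<in> carrier G. h x \<in> N} \<lhd> G" (is "?K \<lhd> G")
proof -
  interpret N: normal N H by fact
  have "subgroup ?K G"
    by (rule G.subgroupI) (auto intro: N.m_closed exI[of _ "\<one>\<^bsub>G\<^esub>"])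
  then show ?thesis
    using N.inv_op_closed2 by (auto simp: G.normal_inv_iff)
qed

lemma (in group) conjugacy_class_self:
  assumes "x \<in> carrier G"
  shows "x \<in> conjugacy_class G x"
proof -
  have "x = \<one> \<otimes> x \<otimes> inv \<one>" using assms by simp
  then show ?thesis unfolding conjugacy_class_def by blast
qed

lemma (in normal) pow_in_if_conjugate:
  fixes n :: nat
  assumes "g \<in> carrier G" "x \<in> carrier G" "x [^] n \<in> H"
  shows "(g \<otimes> x \<otimes> inv g) [^] n \<in> H"
proof -
  have "(g \<otimes> x \<otimes> inv g) [^] n = g \<otimes> x [^] n \<otimes> inv g"
  proof (induction n)
    case (Suc n)
    have "inv g \<otimes> (g \<otimes> (x \<otimes> inv g)) = x \<otimes> inv g"
      using assms by (simp flip: m_assoc)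
    with Suc show ?case using assms by (simp add: m_assoc)
  qed (use assms in simp)
  with assms show ?thesis using inv_op_closed2 by simp
qed

text \<open>Powers commute with conjugation and \<open>H\<close> is invariant under it. With ball
  stabilisers for \<open>H\<close>, this is the invariant that distinguishes isometry types.\<close>

lemma (in normal) pow_in_iff_of_conjugacy_class_eq:
  fixes n :: nat
  assumes "x \<in> carrier G" "y \<in> carrier G" "conjugacy_class G x = conjugacy_class G y"
  shows "x [^] n \<in> H \<longleftrightarrow> y [^] n \<in> H"
proof -
  have "x \<in> conjugacy_class G y" "y \<in> conjugacy_class G x"
    using conjugacy_class_self assms by auto
  then obtain g h where "g \<in> carrier G" "x = g \<otimes> y \<otimes> inv g" "h \<in> carrier G" "y = h \<otimes> x \<otimes> inv h"
    unfolding conjugacy_class_def by blast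
  then show ?thesis
    using pow_in_if_conjugate[of g y n] pow_in_if_conjugate[of h x n] assms by metis
qed

section \<open>Finiteness of spheres and balls about the root\<close>

lemma successively_relpow:
  assumes "p \<noteq> []" "successively (\<lambda>x y. (x, y) \<in> E) p"
  shows "(hd p, last p) \<in> E ^^ (length p - 1)"
  using assms
proof (induction p rule: induct_list012)
  case (3 x y zs)
  then show ?case
    using relpow_Suc_I2[of x y E "last (y # zs)" "length zs"] by simp
qed auto

context homogeneous_tree
begin

text \<open>The \<open>LEAST\<close> in \<open>graph_dist\<close> is attained because
  \<open>unique_path\<close> supplies a walk from the root.\<close>

lemma relpow_graph_dist:
  assumes "v \<in> V"
  shows "(r, v) \<in> E ^^ graph_dist E r v"
proof -
  obtain p where "simple_path V E r v p"
    using unique_path[OF root_in assms] by blast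
  then have "(r, v) \<in> E ^^ (length p - 1)"
    using successively_relpow[of p E] by (auto simp: simple_path_def)
  then show ?thesis
    unfolding graph_dist_def by (rule LeastI)
qed

text \<open>The last but one vertex of a shortest walk to a vertex at distance \<open>Suc n\<close>
  has distance \<open>n\<close>, and every vertex has finitely many children.\<close>

lemma finite_sphere: "finite {v \<in> V. graph_dist E r v = n}"
proof (induction n)
  case 0
  have "{v \<in> V. graph_dist E r v = 0} \<subseteq> {r}"
    using relpow_graph_dist by force
  then show ?case using finite_subset by blast
next
  case (Suc n)
  let ?C = "\<lambda>u. {w. (u, w) \<in> E \<and> graph_dist E r w = Suc (graph_dist E r u)}"
  have "{v \<in> V. graph_dist E r v = Suc n} \<subseteq> (\<Union>u\<in>{v \<in> V. graph_dist E r v = n}. ?C u)"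
  proof
    fix v assume v: "v \<in> {v \<in> V. graph_dist E r v = Suc n}"
    then have "(r, v) \<in> E ^^ Suc n" using relpow_graph_dist[of v] by simp
    then obtain u where u: "(r, u) \<in> E ^^ n" "(u, v) \<in> E" by auto
    then have uV: "u \<in> V" using edges(1) by blast
    have "(r, v) \<in> E ^^ Suc (graph_dist E r u)"
      using relpow_graph_dist[OF uV] u(2) by auto
    then have "graph_dist E r v \<le> Suc (graph_dist E r u)"
      unfolding graph_dist_def[of E r v] by (rule Least_le)
    then have "Suc n \<le> Suc (graph_dist E r u)" using v by simp
    moreover have "graph_dist E r u \<le> n"
      unfolding graph_dist_def using u(1) by (rule Least_le)
    ultimately have "graph_dist E r u = n" by simp
    with u uV v show "v \<in> (\<Union>u\<in>{v \<in> V. graph_dist E r v = n}. ?C u)" by auto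
  qed
  \<comment> \<open>An infinite set of children would have \<open>card\<close> equal to 0, against
    positivity of \<open>m\<close>.\<close>
  moreover have "finite (?C u)" if "u \<in> V" for u
    using branching[OF that] m_pos by (metis card.infinite less_irrefl)
  ultimately show ?case
    using Suc finite_subset by (metis (no_types, lifting) finite_UN mem_Collect_eq)
qed

section \<open>Pointwise stabilisers of balls\<close>

definition root_ball :: "nat \<Rightarrow> 'v set" where
  "root_ball l = {v \<in> V. graph_dist E r v \<le> l}"

lemma finite_root_ball: "finite (root_ball l)"
proof -
  have "root_ball l = (\<Union>n\<le>l. {v \<in> V. graph_dist E r v = n})"
    by (auto simp: root_ball_def)
  then show ?thesis using finite_sphere by simp
qed

lemma carrier_Iso: "carrier (Iso V E r) = isometries V E r"
  by (simp add: Iso_def)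

lemma one_Iso: "\<one>\<^bsub>Iso V E r\<^esub> = (\<lambda>x\<in>V. x)"
  by (simp add: Iso_def BijGroup_def)

lemma Iso_mult_apply:
  assumes "f \<in> isometries V E r" "g \<in> isometries V E r" "v \<in> V"
  shows "(f \<otimes>\<^bsub>Iso V E r\<^esub> g) v = f (g v)"
  using assms by (simp add: Iso_def BijGroup_def isometries_def compose_def)

lemma isometry_root_ball:
  assumes "f \<in> isometries V E r" "v \<in> root_ball l"
  shows "f v \<in> root_ball l"
proof -
  have "f \<in> Bij V" "f r = r" "graph_dist E (f r) (f v) = graph_dist E r v"
    using assms root_in by (auto simp: isometries_def root_ball_def)
  with assms(2) show ?thesis
    using Bij_imp_funcset[of f V] by (auto simp: root_ball_def)
qed

definition ball_stabilizer :: "nat \<Rightarrow> ('v \<Rightarrow> 'v) set" where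
  "ball_stabilizer l = {f \<in> isometries V E r. \<forall>v\<in>root_ball l. f v = v}"

text \<open>Normality holds because isometries fixing the root map each ball about it into
  itself.\<close>

lemma normal_ball_stabilizer: "ball_stabilizer l \<lhd> Iso V E r"
proof -
  interpret Iso: group "Iso V E r" using root_in by (rule group_Iso)
  have ball: "v \<in> V" if "v \<in> root_ball l" for v using that by (simp add: root_ball_def)
  have inv: "inv\<^bsub>Iso V E r\<^esub> f \<in> isometries V E r" if "f \<in> isometries V E r" for f
    using Iso.inv_closed that by (simp add: carrier_Iso)
  have mult: "f \<otimes>\<^bsub>Iso V E r\<^esub> g \<in> isometries V E r"
    if "f \<in> isometries V E r" "g \<in> isometries V E r" for f g
    using Iso.m_closed that by (simp add: carrier_Iso)
  have inv1: "(inv\<^bsub>Iso V E r\<^esub> f) (f v) = v" and inv2: "f ((inv\<^bsub>Iso V E r\<^esub> f) v) = v"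
    if "f \<in> isometries V E r" "v \<in> V" for f v
    using that inv[OF that(1)] Iso.l_inv[of f] Iso.r_inv[of f]
    by (simp_all add: carrier_Iso one_Iso flip: Iso_mult_apply)
  have "subgroup (ball_stabilizer l) (Iso V E r)"
  proof (rule Iso.subgroupI)
    show "ball_stabilizer l \<subseteq> carrier (Iso V E r)"
      by (auto simp: ball_stabilizer_def carrier_Iso)
    have "\<one>\<^bsub>Iso V E r\<^esub> \<in> ball_stabilizer l"
      using Iso.one_closed ball by (auto simp: ball_stabilizer_def carrier_Iso one_Iso)
    then show "ball_stabilizer l \<noteq> {}" by blast
  next
    fix f assume f: "f \<in> ball_stabilizer l"
    then have "(inv\<^bsub>Iso V E r\<^esub> f) v = v" if "v \<in> root_ball l" for v
      using inv1[of f v] ball[OF that] that by (simp add: ball_stabilizer_def)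
    with f inv show "inv\<^bsub>Iso V E r\<^esub> f \<in> ball_stabilizer l"
      by (simp add: ball_stabilizer_def)
  next
    fix f g assume "f \<in> ball_stabilizer l" "g \<in> ball_stabilizer l"
    then show "f \<otimes>\<^bsub>Iso V E r\<^esub> g \<in> ball_stabilizer l"
      using ball mult by (simp add: ball_stabilizer_def Iso_mult_apply)
  qed
  moreover have "g \<otimes>\<^bsub>Iso V E r\<^esub> f \<otimes>\<^bsub>Iso V E r\<^esub> inv\<^bsub>Iso V E r\<^esub> g \<in> ball_stabilizer l"
    if g: "g \<in> isometries V E r" and f: "f \<in> ball_stabilizer l" for f g
  proof -
    have f': "f \<in> isometries V E r" using f by (simp add: ball_stabilizer_def)
    have "(g \<otimes>\<^bsub>Iso V E r\<^esub> f \<otimes>\<^bsub>Iso V E r\<^esub> inv\<^bsub>Iso V E r\<^esub> g) v = v" if v: "v \<in> root_ball l" for v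
    proof -
      have w: "(inv\<^bsub>Iso V E r\<^esub> g) v \<in> root_ball l"
        using inv[OF g] v by (rule isometry_root_ball)
      then have "f ((inv\<^bsub>Iso V E r\<^esub> g) v) = (inv\<^bsub>Iso V E r\<^esub> g) v"
        using f by (simp add: ball_stabilizer_def)
      then show ?thesis
        using inv2[OF g ball[OF v]] g f' inv[OF g] mult ball[OF v] ball[OF w]
        by (simp add: Iso_mult_apply)
    qed
    then show ?thesis using g f' inv mult by (simp add: ball_stabilizer_def)
  qed
  ultimately show ?thesis
    by (simp add: Iso.normal_inv_iff carrier_Iso)
qed

text \<open>Openness comes from continuity of the evaluations at the finitely many vertices of a
  ball. The intersection is trivial because the balls exhaust \<open>V\<close> and
  \<open>\<rho>\<close> is injective.\<close>

lemma filtered_profinite_group_of_representation: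
  assumes "profinite_group G \<tau>" "faithful_representation G \<tau> V E r \<rho>"
  shows "filtered_profinite_group G \<tau> (\<lambda>l. {g \<in> carrier G. \<rho> g \<in> ball_stabilizer l})"
proof -
  interpret profinite_group G \<tau> by fact
  interpret \<rho>: group_hom G "Iso V E r" \<rho>
    using assms(2) group_Iso[OF root_in] is_group
    by (simp add: group_hom_def group_hom_axioms_def faithful_representation_def)
  define K where "K l = {g \<in> carrier G. \<rho> g \<in> ball_stabilizer l}" for l
  have iso: "\<rho> g \<in> isometries V E r" if "g \<in> carrier G" for g
    using \<rho>.hom_closed[OF that] by (simp add: carrier_Iso)
  have "filtered_profinite_group G \<tau> K"
  proof (intro filtered_profinite_group.intro filtered_profinite_group_axioms.intro)
    show "profinite_group G \<tau>" by fact
    show "K l \<lhd> G" for l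
      unfolding K_def using normal_ball_stabilizer by (rule \<rho>.normal_vimage)
  next
    fix l
    have cont: "continuous_map \<tau> (product_topology (\<lambda>_. discrete_topology V) V) \<rho>"
      using assms(2) by (simp add: faithful_representation_def Iso_topology_def continuous_map_in_subtopology)
    have "openin \<tau> {g \<in> topspace \<tau>. \<rho> g v \<in> {v}}" if "v \<in> V" for v
    proof (rule openin_continuous_map_preimage)
      show "continuous_map \<tau> (discrete_topology V) (\<lambda>g. \<rho> g v)"
        using cont that by (simp add: continuous_map_componentwise)
    qed (use that in simp)
    then have "openin \<tau> ((\<Inter>v\<in>root_ball l. {g \<in> topspace \<tau>. \<rho> g v \<in> {v}}) \<inter> topspace \<tau>)"
      using finite_root_ball by (intro openin_INT) (auto simp: root_ball_def)
    moreover have "(\<Inter>v\<in>root_ball l. {g \<in> topspace \<tau>. \<rho> g v \<in> {v}}) \<inter> topspace \<tau> = K l"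
      using iso topspace by (auto simp: K_def ball_stabilizer_def)
    ultimately show "openin \<tau> (K l)" by simp
  next
    show "decseq K"
      by (auto simp: decseq_def K_def ball_stabilizer_def root_ball_def)
  next
    have "g = \<one>\<^bsub>G\<^esub>" if "g \<in> carrier G" "\<And>l. \<rho> g \<in> ball_stabilizer l" for g
    proof -
      have "\<rho> g v = v" if "v \<in> V" for v
        using \<open>\<rho> g \<in> ball_stabilizer (graph_dist E r v)\<close> that
        by (simp add: ball_stabilizer_def root_ball_def)
      \<comment> \<open>Elements of \<open>Bij V\<close> have a fixed default value outside
        \<open>V\<close>, so agreement on \<open>V\<close> suffices for equality.\<close>
      moreover have "\<rho> g \<in> extensional V"
        using iso[OF that(1)] Bij_imp_extensional by (auto simp: isometries_def)
      ultimately have "\<rho> g = \<one>\<^bsub>Iso V E r\<^esub>"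
        unfolding one_Iso by (intro extensionalityI[of _ V]) auto
      then show ?thesis
        using assms(2) that(1) by (simp add: faithful_representation_def inj_on_def flip: \<rho>.hom_one)
    qed
    moreover have "\<one>\<^bsub>G\<^esub> \<in> K l" for l
      using subgroup.one_closed[OF normal_imp_subgroup[OF normal_ball_stabilizer]]
      by (simp add: K_def)
    ultimately show "(\<Inter>l. K l) = {\<one>\<^bsub>G\<^esub>}"
      unfolding K_def by blast
  qed
  then show ?thesis unfolding K_def[abs_def] .
qed

text \<open>Sending \<open>A\<close> to the conjugacy class of \<open>\<rho> (a A)\<close> is
  injective, so the image of \<open>G\<close> meets at least continuum many classes.\<close>

lemma not_small_isometry_types_if_power_separated:
  assumes "profinite_group G \<tau>" "faithful_representation G \<tau> V E r \<rho>"
    and a: "power_separated G (\<lambda>l. {g \<in> carrier G. \<rho> g \<in> ball_stabilizer l}) a"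
  shows "\<not> small_isometry_types G V E r \<rho>"
proof -
  interpret profinite_group G \<tau> by fact
  interpret \<rho>: group_hom G "Iso V E r" \<rho>
    using assms(2) group_Iso[OF root_in] is_group
    by (simp add: group_hom_def group_hom_axioms_def faithful_representation_def)
  have carr: "a A \<in> carrier G" for A
    using a by (auto simp: power_separated_def)
  let ?c = "\<lambda>A. conjugacy_class (Iso V E r) (\<rho> (a A))"
  let ?X = "{C \<in> conjugacy_classes (Iso V E r). C \<inter> \<rho> ` carrier G \<noteq> {}}"
  have "inj ?c"
  proof (rule injI, rule ccontr)
    fix A B assume eq: "?c A = ?c B" and "A \<noteq> B"
    have "(\<rho> (a A [^]\<^bsub>G\<^esub> e) \<in> ball_stabilizer l) = (\<rho> (a B [^]\<^bsub>G\<^esub> e) \<in> ball_stabilizer l)" for e l :: nat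
      using normal.pow_in_iff_of_conjugacy_class_eq[OF normal_ball_stabilizer _ _ eq] carr
      by (simp add: \<rho>.hom_nat_pow)
    moreover have "\<exists>l e::nat. (a A [^]\<^bsub>G\<^esub> e \<in> {g \<in> carrier G. \<rho> g \<in> ball_stabilizer l}) \<noteq>
        (a B [^]\<^bsub>G\<^esub> e \<in> {g \<in> carrier G. \<rho> g \<in> ball_stabilizer l})"
      using a \<open>A \<noteq> B\<close> unfolding power_separated_def by (elim conjE allE impE)
    ultimately show False using carr by simp
  qed
  moreover have "range ?c \<subseteq> ?X"
  proof (rule image_subsetI, rule CollectI, rule conjI)
    fix A
    show "?c A \<in> conjugacy_classes (Iso V E r)"
      unfolding conjugacy_classes_def by (intro imageI \<rho>.hom_closed carr)
    have "\<rho> (a A) \<in> ?c A"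
      by (intro \<rho>.H.conjugacy_class_self \<rho>.hom_closed carr)
    moreover have "\<rho> (a A) \<in> \<rho> ` carrier G"
      by (intro imageI carr)
    ultimately have "\<rho> (a A) \<in> ?c A \<inter> \<rho> ` carrier G" by (rule IntI)
    then show "?c A \<inter> \<rho> ` carrier G \<noteq> {}" by (metis empty_iff)
  qed
  \<comment> \<open>By Schroeder-Bernstein this excludes that \<open>?X\<close> is strictly
    smaller.\<close>
  ultimately have "(UNIV :: nat set set) \<lesssim> ?X"
    unfolding lepoll_def by blast
  then show ?thesis
    unfolding small_isometry_types_def lesspoll_def using lepoll_antisym by blast
qed

end

theorem theorem2p4:
  fixes V :: "'v set" and E :: "('v \<times> 'v) set" and r :: 'v and m :: "nat \<Rightarrow> nat"
    and G :: "('g, 'b) monoid_scheme" and \<tau> :: "'g topology"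
  assumes "homogeneous_tree V E r m"
  shows
    "(pronilpotent_group G \<tau> \<and>
        (\<exists>\<rho>. faithful_representation G \<tau> V E r \<rho> \<and> small_isometry_types G V E r \<rho>)
      \<longrightarrow> finite (order_primes G \<tau>)) \<and>
     (profinite_group G \<tau> \<and> nilpotent_group G \<and>
        (\<exists>\<rho>. faithful_representation G \<tau> V E r \<rho> \<and> small_isometry_types G V E r \<rho>)
      \<longrightarrow> finite_exponent G (periodic_part G))"
proof -
  interpret homogeneous_tree V E r m by fact
  have "finite (order_primes G \<tau>)"
    if G: "pronilpotent_group G \<tau>" and \<rho>: "faithful_representation G \<tau> V E r \<rho>"
      "small_isometry_types G V E r \<rho>" for \<rho>
  proof (rule ccontr)
    assume inf: "infinite (order_primes G \<tau>)"
    have pro: "profinite_group G \<tau>" using G by (simp add: pronilpotent_group_def)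
    interpret filtered_profinite_group G \<tau> "\<lambda>l. {g \<in> carrier G. \<rho> g \<in> ball_stabilizer l}"
      using pro \<rho>(1) by (rule filtered_profinite_group_of_representation)
    obtain a where "power_separated G (\<lambda>l. {g \<in> carrier G. \<rho> g \<in> ball_stabilizer l}) a"
      using separated_family_of_infinitely_many_primes[OF G inf] ..
    from not_small_isometry_types_if_power_separated[OF pro \<rho>(1) this] \<rho>(2) show False ..
  qed
  moreover have "finite_exponent G (periodic_part G)"
    if pro: "profinite_group G \<tau>" and G: "nilpotent_group G"
      and \<rho>: "faithful_representation G \<tau> V E r \<rho>" "small_isometry_types G V E r \<rho>" for \<rho>
  proof (rule ccontr)
    assume inf: "\<not> finite_exponent G (periodic_part G)"
    interpret filtered_profinite_group G \<tau> "\<lambda>l. {g \<in> carrier G. \<rho> g \<in> ball_stabilizer l}"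
      using pro \<rho>(1) by (rule filtered_profinite_group_of_representation)
    obtain a where "power_separated G (\<lambda>l. {g \<in> carrier G. \<rho> g \<in> ball_stabilizer l}) a"
      using separated_family_of_unbounded_torsion[OF G inf] ..
    from not_small_isometry_types_if_power_separated[OF pro \<rho>(1) this] \<rho>(2) show False ..
  qed
  ultimately show ?thesis by blast
qed

end
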